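(* Let $G$ be a countable discrete group and $\sigma$ a family of finite-index subgroups of $G$. Then \[ \operatorname{asdim}(\square_\sigma G)=\sup_{\tau}\operatorname{asdim}(\square_\tau G), \] where the supremum is over all countable subfamilies $\tau\subset\sigma$. Moreover, if $\sigma$ is nested, then the supremum may be taken over all nested countable subfamilies $\tau\subset\sigma$.
   Context: A coarse space is a set $X$ with a collection $\mathcal E$ of subsets of $X\times X$ (entourages) that contains the diagonal and is closed under subsets, finite unions, inverses and compositions. It is connected if $\{(x,y)\}\in\mathcal E$ for all $x,y\in X$. A coarse space $(X,\mathcal E)$ has $\operatorname{asdim}(X)\le n$ if for every $E\in\mathcal E$ there is a cover $\mathcal U$ of $X$ such that $\bigcup_{U\in\mathcal U}U\times U\in\mathcal E$, any $n+2$ distinct members of $\mathcal U$ have empty intersection, and every non-empty $A\subseteq X$ with $A\times A\subseteq E$ is contained in some $U\in\mathcal U$. $\operatorname{asdim}(X)\in\{0,1,2,\dots\}\cup\{\infty\}$ is the least such $n$, or $\infty$ if there is none. Let $G$ be a countable discrete group and $\sigma=(G_\alpha)_\alpha$ a family (repetitions allowed) of finite-index, not necessarily normal, subgroups. The box space $\square_\sigma G$ is the set $\bigsqcup_\alpha G/G_\alpha$ (left cosets, with $G$ acting by left multiplication) equipped with the smallest connected $G$-invariant coarse structure containing the sets $\Delta_g=\{(x,gx) : x\in\bigsqcup_\alpha G/G_\alpha\}$ for all $g\in G$. A family of subgroups is nested if for any two of its members there is a member contained in both (i.e. it is directed under reverse inclusion). *)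

theory Defs
  imports "HOL-Algebra.Left_Coset" "HOL-Library.Extended_Nat" "HOL-Library.Countable_Set"
begin

definition coarse_structure :: "'x set \<Rightarrow> ('x \<times> 'x) set set \<Rightarrow> bool" where
  "coarse_structure X \<E> \<longleftrightarrow>
     \<E> \<subseteq> Pow (X \<times> X) \<and>
     Id_on X \<in> \<E> \<and>
     (\<forall>E\<in>\<E>. \<forall>F. F \<subseteq> E \<longrightarrow> F \<in> \<E>) \<and>
     (\<forall>E\<in>\<E>. \<forall>F\<in>\<E>. E \<union> F \<in> \<E>) \<and>
     (\<forall>E\<in>\<E>. E\<inverse> \<in> \<E>) \<and>
     (\<forall>E\<in>\<E>. \<forall>F\<in>\<E>. E O F \<in> \<E>)"

definition coarsely_connected :: "'x set \<Rightarrow> ('x \<times> 'x) set set \<Rightarrow> bool" where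
  "coarsely_connected X \<E> \<longleftrightarrow> (\<forall>x\<in>X. \<forall>y\<in>X. {(x, y)} \<in> \<E>)"

definition asdim_le :: "'x set \<Rightarrow> ('x \<times> 'x) set set \<Rightarrow> nat \<Rightarrow> bool" where
  "asdim_le X \<E> n \<longleftrightarrow>
     (\<forall>E\<in>\<E>. \<exists>\<U>. \<U> \<subseteq> Pow X \<and> \<Union>\<U> = X \<and>
        (\<Union>U\<in>\<U>. U \<times> U) \<in> \<E> \<and>
        (\<forall>\<V>. \<V> \<subseteq> \<U> \<and> card \<V> = n + 2 \<longrightarrow> \<Inter>\<V> = {}) \<and>
        (\<forall>A. A \<noteq> {} \<and> A \<subseteq> X \<and> A \<times> A \<subseteq> E \<longrightarrow> (\<exists>U\<in>\<U>. A \<subseteq> U)))"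

text \<open>In \<^typ>\<open>enat\<close> the infimum of the empty set is \<open>\<infinity>\<close>, and that of a non-empty set is its
  least element.\<close>

definition asdim :: "'x set \<Rightarrow> ('x \<times> 'x) set set \<Rightarrow> enat" where
  "asdim X \<E> = Inf {enat n | n. asdim_le X \<E> n}"

text \<open>A family of subgroups is given by an index set \<open>I\<close> and a map \<open>S\<close>, so repetitions are
  allowed, and a subfamily is a subset of \<open>I\<close>. The index is kept as the first component of a point
  of the box space, which makes the union of the coset spaces disjoint.\<close>

definition box_points :: "('a, 'm) monoid_scheme \<Rightarrow> 'i set \<Rightarrow> ('i \<Rightarrow> 'a set) \<Rightarrow> ('i \<times> 'a set) set" where
  "box_points G I S = (SIGMA i:I. lcosets\<^bsub>G\<^esub> (S i))"

definition box_act :: "('a, 'm) monoid_scheme \<Rightarrow> 'a \<Rightarrow> 'i \<times> 'a set \<Rightarrow> 'i \<times> 'a set" where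
  "box_act G g x = (fst x, g <#\<^bsub>G\<^esub> snd x)"

definition box_graph ::
    "('a, 'm) monoid_scheme \<Rightarrow> 'i set \<Rightarrow> ('i \<Rightarrow> 'a set) \<Rightarrow> 'a \<Rightarrow> (('i \<times> 'a set) \<times> ('i \<times> 'a set)) set" where
  "box_graph G I S g = {(x, box_act G g x) | x. x \<in> box_points G I S}"

text \<open>Invariance means that every group element maps entourages to entourages. It does not require
  the union of all translates of an entourage to be an entourage.\<close>

definition box_invariant ::
    "('a, 'm) monoid_scheme \<Rightarrow> (('i \<times> 'a set) \<times> ('i \<times> 'a set)) set set \<Rightarrow> bool" where
  "box_invariant G \<E> \<longleftrightarrow>
     (\<forall>g\<in>carrier G. \<forall>E\<in>\<E>. map_prod (box_act G g) (box_act G g) ` E \<in> \<E>)"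

definition box_entourages ::
    "('a, 'm) monoid_scheme \<Rightarrow> 'i set \<Rightarrow> ('i \<Rightarrow> 'a set) \<Rightarrow> (('i \<times> 'a set) \<times> ('i \<times> 'a set)) set set" where
  "box_entourages G I S =
     \<Inter>{\<E>. coarse_structure (box_points G I S) \<E> \<and>
         coarsely_connected (box_points G I S) \<E> \<and>
         box_invariant G \<E> \<and>
         (\<forall>g\<in>carrier G. box_graph G I S g \<in> \<E>)}"

definition box_asdim :: "('a, 'm) monoid_scheme \<Rightarrow> 'i set \<Rightarrow> ('i \<Rightarrow> 'a set) \<Rightarrow> enat" where
  "box_asdim G I S = asdim (box_points G I S) (box_entourages G I S)"

definition nested_family :: "'i set \<Rightarrow> ('i \<Rightarrow> 'a set) \<Rightarrow> bool" where
  "nested_family I S \<longleftrightarrow> (\<forall>i\<in>I. \<forall>j\<in>I. \<exists>k\<in>I. S k \<subseteq> S i \<and> S k \<subseteq> S j)"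

end

theory Submission
  imports Defs
begin

text \<open>An entourage of the box space is a set of pairs lying, up to finitely many pairs, in the orbit
  relation of a finite subset of \<open>G\<close>. Covers restrict to subspaces, so the dimension is monotone in
  the family. For the converse fix a finite \<open>F\<close> and call a component bad for a finite \<open>D\<close> if it has
  no cover of multiplicity at most \<open>n + 1\<close> with Lebesgue scale \<open>F\<close> and mesh \<open>D\<close>. If only finitely
  many components are bad for some \<open>D\<close>, merging them (and the finitely many components met by the
  exceptional pairs) into one finite set and covering the others separately covers the whole space.
  Otherwise, since \<open>G\<close> has only countably many finite subsets, some countable subfamily has
  infinitely many bad components for every \<open>D\<close>. This subfamily, and any larger one, has dimension
  greater than \<open>n\<close>, because the exceptional pairs of a mesh entourage miss one of the bad components.\<close>

section \<open>Covers and asymptotic dimension\<close>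

text \<open>The mesh bound \<open>D\<close> is a separate parameter, and neither \<open>E\<close>
  nor \<open>D\<close> has to lie in \<open>X \<times> X\<close>. One pair of relations can
  therefore serve all components at once, which is the uniformity that bad components
  violate.\<close>

definition asdim_cover ::
    "'x set \<Rightarrow> ('x \<times> 'x) set \<Rightarrow> ('x \<times> 'x) set \<Rightarrow> nat \<Rightarrow> 'x set set \<Rightarrow> bool" where
  "asdim_cover X E D n \<U> \<longleftrightarrow> \<U> \<subseteq> Pow X \<and> \<Union>\<U> = X \<and> (\<Union>U\<in>\<U>. U \<times> U) \<subseteq> D \<and>
     (\<forall>\<V>. \<V> \<subseteq> \<U> \<and> card \<V> = n + 2 \<longrightarrow> \<Inter>\<V> = {}) \<and>
     (\<forall>A. A \<noteq> {} \<and> A \<subseteq> X \<and> A \<times> A \<subseteq> E \<longrightarrow> (\<exists>U\<in>\<U>. A \<subseteq> U))"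

lemma asdim_le_iff_cover:
  assumes "\<And>D F. D \<in> \<E> \<Longrightarrow> F \<subseteq> D \<Longrightarrow> F \<in> \<E>"
  shows "asdim_le X \<E> n \<longleftrightarrow> (\<forall>E\<in>\<E>. \<exists>D\<in>\<E>. \<exists>\<U>. asdim_cover X E D n \<U>)"
proof
  assume le: "asdim_le X \<E> n"
  show "\<forall>E\<in>\<E>. \<exists>D\<in>\<E>. \<exists>\<U>. asdim_cover X E D n \<U>"
  proof
    fix E assume "E \<in> \<E>"
    from bspec[OF le[unfolded asdim_le_def] this] obtain \<U> where "\<U> \<subseteq> Pow X" "\<Union>\<U> = X" "(\<Union>U\<in>\<U>. U \<times> U) \<in> \<E>"
      "\<forall>\<V>. \<V> \<subseteq> \<U> \<and> card \<V> = n + 2 \<longrightarrow> \<Inter>\<V> = {}"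
      "\<forall>A. A \<noteq> {} \<and> A \<subseteq> X \<and> A \<times> A \<subseteq> E \<longrightarrow> (\<exists>U\<in>\<U>. A \<subseteq> U)"
      by (elim exE conjE)
    then show "\<exists>D\<in>\<E>. \<exists>\<U>. asdim_cover X E D n \<U>"
      by (intro bexI[of _ "\<Union>U\<in>\<U>. U \<times> U"] exI[of _ \<U>]) (simp_all add: asdim_cover_def)
  qed
next
  assume *: "\<forall>E\<in>\<E>. \<exists>D\<in>\<E>. \<exists>\<U>. asdim_cover X E D n \<U>"
  show "asdim_le X \<E> n"
    unfolding asdim_le_def
  proof
    fix E assume "E \<in> \<E>"
    with * obtain D \<U> where "D \<in> \<E>" and cov: "asdim_cover X E D n \<U>" by blast
    then have "(\<Union>U\<in>\<U>. U \<times> U) \<in> \<E>"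
      using assms by (simp add: asdim_cover_def)
    with cov show "\<exists>\<U>. \<U> \<subseteq> Pow X \<and> \<Union>\<U> = X \<and> (\<Union>U\<in>\<U>. U \<times> U) \<in> \<E> \<and>
        (\<forall>\<V>. \<V> \<subseteq> \<U> \<and> card \<V> = n + 2 \<longrightarrow> \<Inter>\<V> = {}) \<and>
        (\<forall>A. A \<noteq> {} \<and> A \<subseteq> X \<and> A \<times> A \<subseteq> E \<longrightarrow> (\<exists>U\<in>\<U>. A \<subseteq> U))"
      unfolding asdim_cover_def by (intro exI[of _ \<U>]) simp
  qed
qed

lemma asdim_cover_mono:
  assumes "asdim_cover X E D n \<U>" "D \<subseteq> D'"
  shows "asdim_cover X E D' n \<U>"
  using assms unfolding asdim_cover_def by (elim conjE, intro conjI) (assumption | rule order_trans)+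

lemma asdim_coverD:
  assumes "asdim_cover X E D n \<U>"
  shows "\<U> \<subseteq> Pow X" "\<Union>\<U> = X" "\<And>U. U \<in> \<U> \<Longrightarrow> U \<times> U \<subseteq> D"
    "\<And>\<V>. \<V> \<subseteq> \<U> \<Longrightarrow> card \<V> = n + 2 \<Longrightarrow> \<Inter>\<V> = {}"
    "\<And>A. A \<noteq> {} \<Longrightarrow> A \<subseteq> X \<Longrightarrow> A \<times> A \<subseteq> E \<Longrightarrow> \<exists>U\<in>\<U>. A \<subseteq> U"
  using assms by (auto simp: asdim_cover_def)

text \<open>Traces on \<open>Y\<close> of the members of a cover form a cover of \<open>Y\<close>.
  The multiplicity does not grow, since distinct traces come from distinct members.\<close>

lemma asdim_cover_restrict:
  assumes cov: "asdim_cover X E D n \<U>" and "Y \<subseteq> X" "E' \<inter> Y \<times> Y \<subseteq> E"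
  shows "asdim_cover Y E' (D \<inter> Y \<times> Y) n ((\<inter>) Y ` \<U>)"
  unfolding asdim_cover_def
proof (intro conjI allI impI)
  show "(\<inter>) Y ` \<U> \<subseteq> Pow Y" by blast
  show "\<Union>((\<inter>) Y ` \<U>) = Y"
    using asdim_coverD(2)[OF cov] \<open>Y \<subseteq> X\<close> by blast
  show "(\<Union>U\<in>(\<inter>) Y ` \<U>. U \<times> U) \<subseteq> D \<inter> Y \<times> Y"
    using asdim_coverD(3)[OF cov] by blast
  show "\<Inter>\<V> = {}" if V: "\<V> \<subseteq> (\<inter>) Y ` \<U> \<and> card \<V> = n + 2" for \<V>
  proof -
    \<comment> \<open>Different members may have the same trace, so one member is chosen for each
      trace in \<open>\<V>\<close>; this keeps the cardinality.\<close>
    obtain \<W> where W: "\<W> \<subseteq> \<U>" "inj_on ((\<inter>) Y) \<W>" "\<V> = (\<inter>) Y ` \<W>"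
      using V by (auto simp: subset_image_inj)
    then have "card \<W> = n + 2"
      using V by (simp add: card_image)
    then have "\<Inter>\<W> = {}"
      using asdim_coverD(4)[OF cov] W(1) by blast
    then show ?thesis
      using W(3) by blast
  qed
  show "\<exists>U\<in>(\<inter>) Y ` \<U>. A \<subseteq> U" if A: "A \<noteq> {} \<and> A \<subseteq> Y \<and> A \<times> A \<subseteq> E'" for A
  proof -
    have "A \<subseteq> X" using A assms(2) by blast
    moreover have "A \<times> A \<subseteq> E" using A assms(3) by blast
    ultimately obtain U where "U \<in> \<U>" "A \<subseteq> U"
      using asdim_coverD(5)[OF cov, of A] A by auto
    then show ?thesis using A by (intro bexI[of _ "Y \<inter> U"]) simp_all
  qed
qed

text \<open>The same covers work: among \<open>n + 2\<close> members with a common point there would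
  be \<open>m + 2\<close> such members.\<close>

lemma asdim_le_mono:
  assumes le: "asdim_le X \<E> m" and "m \<le> n"
  shows "asdim_le X \<E> n"
  unfolding asdim_le_def
proof
  fix E assume "E \<in> \<E>"
  from bspec[OF le[unfolded asdim_le_def] this] obtain \<U> where
    U: "\<U> \<subseteq> Pow X" "\<Union>\<U> = X" "(\<Union>U\<in>\<U>. U \<times> U) \<in> \<E>"
      "\<forall>A. A \<noteq> {} \<and> A \<subseteq> X \<and> A \<times> A \<subseteq> E \<longrightarrow> (\<exists>U\<in>\<U>. A \<subseteq> U)"
    and m: "\<forall>\<V>. \<V> \<subseteq> \<U> \<and> card \<V> = m + 2 \<longrightarrow> \<Inter>\<V> = {}"
    by (elim exE conjE)
  have "\<Inter>\<V> = {}" if V: "\<V> \<subseteq> \<U> \<and> card \<V> = n + 2" for \<V>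
  proof -
    have "m + 2 \<le> card \<V>" using V \<open>m \<le> n\<close> by simp
    then obtain \<W> where W: "\<W> \<subseteq> \<V>" "card \<W> = m + 2"
      by (rule obtain_subset_with_card_n)
    then have "\<Inter>\<W> = {}" using m V by (meson order_trans)
    then show ?thesis using W(1) by blast
  qed
  then show "\<exists>\<U>. \<U> \<subseteq> Pow X \<and> \<Union>\<U> = X \<and> (\<Union>U\<in>\<U>. U \<times> U) \<in> \<E> \<and>
      (\<forall>\<V>. \<V> \<subseteq> \<U> \<and> card \<V> = n + 2 \<longrightarrow> \<Inter>\<V> = {}) \<and>
      (\<forall>A. A \<noteq> {} \<and> A \<subseteq> X \<and> A \<times> A \<subseteq> E \<longrightarrow> (\<exists>U\<in>\<U>. A \<subseteq> U))"
    using U by (intro exI[of _ \<U>] conjI allI impI) simp_all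
qed

lemma asdim_le_enat_iff: "asdim X \<E> \<le> enat n \<longleftrightarrow> asdim_le X \<E> n"
proof
  assume le: "asdim X \<E> \<le> enat n"
  let ?A = "{enat n | n. asdim_le X \<E> n}"
  \<comment> \<open>The infimum of the empty set is \<open>\<infinity>\<close>, so a finite bound
    excludes it; the infimum of a non-empty set in \<open>enat\<close> is attained.\<close>
  have "?A \<noteq> {}"
    using le unfolding asdim_def by (auto simp: top_enat_def simp del: Collect_empty_eq)
  then have "asdim X \<E> \<in> ?A"
    unfolding asdim_def Inf_enat_def by (auto intro: LeastI)
  then show "asdim_le X \<E> n"
    using le asdim_le_mono by auto
qed (auto simp: asdim_def intro: Inf_lower)

section \<open>Entourages of box spaces\<close>

text \<open>Not cut down to a box space, so that the same relation serves a family, its subfamilies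
  and single components.\<close>

definition orbit_rel :: "('a, 'm) monoid_scheme \<Rightarrow> 'a set \<Rightarrow> (('i \<times> 'a set) \<times> ('i \<times> 'a set)) set" where
  "orbit_rel G F = {(x, box_act G g x) | x g. g \<in> F}"

lemma fst_box_act [simp]: "fst (box_act G g x) = fst x"
  by (simp add: box_act_def)

lemma box_points_mono: "J \<subseteq> I \<Longrightarrow> box_points G J S \<subseteq> box_points G I S"
  by (auto simp: box_points_def)

lemma orbit_rel_same_fst: "(x, y) \<in> orbit_rel G F \<Longrightarrow> fst x = fst y"
  by (auto simp: orbit_rel_def)

locale subgroup_family = group G for G :: "('a, 'm) monoid_scheme" (structure) +
  fixes I :: "'i set" and S :: "'i \<Rightarrow> 'a set"
  assumes subgroups: "i \<in> I \<Longrightarrow> subgroup (S i) G"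
begin

lemma subfamily: "J \<subseteq> I \<Longrightarrow> subgroup_family G J S"
  by (intro subgroup_family.intro subgroup_family_axioms.intro is_group subgroups) blast

lemma box_points_subset_carrier:
  assumes "x \<in> box_points G I S"
  shows "snd x \<subseteq> carrier G"
proof -
  obtain i a where "snd x = a <# S i" "i \<in> I" "a \<in> carrier G"
    using assms by (auto simp: box_points_def LCOSETS_def)
  then show ?thesis
    using subgroups[THEN subgroup.subset] by (simp add: l_coset_subset_G)
qed

lemma box_act_closed:
  assumes "g \<in> carrier G" "x \<in> box_points G I S"
  shows "box_act G g x \<in> box_points G I S"
proof -
  obtain i a where x: "x = (i, a <# S i)" "i \<in> I" "a \<in> carrier G"
    using assms(2) by (auto simp: box_points_def LCOSETS_def)
  then have "g <# (a <# S i) = (g \<otimes> a) <# S i"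
    using assms(1) subgroups[THEN subgroup.subset] by (intro lcos_m_assoc) auto
  then show ?thesis
    using x assms(1) by (auto simp: box_points_def box_act_def LCOSETS_def)
qed

lemma box_act_mult:
  assumes "g \<in> carrier G" "h \<in> carrier G" "x \<in> box_points G I S"
  shows "box_act G g (box_act G h x) = box_act G (g \<otimes> h) x"
  using assms box_points_subset_carrier by (simp add: box_act_def lcos_m_assoc)

lemma box_act_one: "x \<in> box_points G I S \<Longrightarrow> box_act G \<one> x = x"
  using box_points_subset_carrier by (simp add: box_act_def lcos_mult_one)

lemma box_act_inv:
  assumes "g \<in> carrier G" "x \<in> box_points G I S"
  shows "box_act G (inv g) (box_act G g x) = x"
  using assms by (simp add: box_act_mult box_act_one)

text \<open>Explicit candidate for the box structure. The finite set \<open>K\<close> accounts for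
  connectedness and may link different components.\<close>

definition controlled :: "(('i \<times> 'a set) \<times> ('i \<times> 'a set)) set set" where
  "controlled = {E. E \<subseteq> box_points G I S \<times> box_points G I S \<and>
     (\<exists>F K. finite F \<and> F \<subseteq> carrier G \<and> finite K \<and> E \<subseteq> orbit_rel G F \<union> K)}"

lemma controlledI:
  assumes "E \<subseteq> box_points G I S \<times> box_points G I S" "finite F" "F \<subseteq> carrier G" "finite K"
    and "\<And>x y. (x, y) \<in> E \<Longrightarrow> (x, y) \<notin> K \<Longrightarrow> \<exists>g\<in>F. y = box_act G g x"
  shows "E \<in> controlled"
proof -
  have "E \<subseteq> orbit_rel G F \<union> K"
  proof
    fix p assume "p \<in> E"
    then show "p \<in> orbit_rel G F \<union> K"
      using assms(5)[of "fst p" "snd p"] by (cases p) (auto simp: orbit_rel_def)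
  qed
  then show ?thesis
    unfolding controlled_def using assms by blast
qed

text \<open>The exceptional set is intersected with \<open>E\<close>, so that its pairs consist of
  points of the box space and connectedness applies to each of them.\<close>

lemma controlledE:
  assumes "E \<in> controlled"
  obtains F K where "E \<subseteq> box_points G I S \<times> box_points G I S" "finite F" "F \<subseteq> carrier G" "finite K"
    "K \<subseteq> E" "\<And>x y. (x, y) \<in> E \<Longrightarrow> (x, y) \<notin> K \<Longrightarrow> \<exists>g\<in>F. y = box_act G g x"
proof -
  obtain F K where "E \<subseteq> box_points G I S \<times> box_points G I S" "finite F" "F \<subseteq> carrier G" "finite K"
    "E \<subseteq> orbit_rel G F \<union> K"
    using assms unfolding controlled_def by blast
  then show thesis
    by (intro that[of F "K \<inter> E"]) (auto simp: orbit_rel_def)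
qed

lemma coarse_structure_controlled: "coarse_structure (box_points G I S) controlled"
  unfolding coarse_structure_def
proof (intro conjI ballI allI impI)
  let ?X = "box_points G I S"
  show "controlled \<subseteq> Pow (?X \<times> ?X)"
    by (auto simp: controlled_def)
  show "Id_on ?X \<in> controlled"
    by (rule controlledI[where F = "{\<one>}" and K = "{}"]) (auto simp: box_act_one)
  fix E assume E: "E \<in> controlled"
  show "F \<in> controlled" if "F \<subseteq> E" for F
    using E that unfolding controlled_def mem_Collect_eq by (meson order_trans)
  obtain F K where F: "E \<subseteq> ?X \<times> ?X" "finite F" "F \<subseteq> carrier G" "finite K" "K \<subseteq> E"
    "\<And>x y. (x, y) \<in> E \<Longrightarrow> (x, y) \<notin> K \<Longrightarrow> \<exists>g\<in>F. y = box_act G g x"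
    using E by (rule controlledE) blast
  show "E\<inverse> \<in> controlled"
  proof (rule controlledI)
    show "E\<inverse> \<subseteq> ?X \<times> ?X" using F by auto
    show "finite ((\<lambda>g. inv g) ` F)" "(\<lambda>g. inv g) ` F \<subseteq> carrier G" "finite (K\<inverse>)"
      using F by auto
    fix x y assume "(x, y) \<in> E\<inverse>" "(x, y) \<notin> K\<inverse>"
    then obtain g where "g \<in> F" "x = box_act G g y" "y \<in> ?X"
      using F by (auto dest: F(6))
    then show "\<exists>g\<in>(\<lambda>g. inv g) ` F. y = box_act G g x"
      using F(3) by (intro bexI[of _ "inv g"]) (auto simp: box_act_inv subset_iff)
  qed
  fix E' assume E': "E' \<in> controlled"
  obtain F' K' where F': "E' \<subseteq> ?X \<times> ?X" "finite F'" "F' \<subseteq> carrier G" "finite K'" "K' \<subseteq> E'"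
    "\<And>x y. (x, y) \<in> E' \<Longrightarrow> (x, y) \<notin> K' \<Longrightarrow> \<exists>g\<in>F'. y = box_act G g x"
    using E' by (rule controlledE) blast
  show "E \<union> E' \<in> controlled"
  proof (rule controlledI)
    show "E \<union> E' \<subseteq> ?X \<times> ?X" "finite (F \<union> F')" "F \<union> F' \<subseteq> carrier G" "finite (K \<union> K')"
      using F F' by auto
    show "\<exists>g\<in>F \<union> F'. y = box_act G g x" if "(x, y) \<in> E \<union> E'" "(x, y) \<notin> K \<union> K'" for x y
      using that F(6)[of x y] F'(6)[of x y] by auto
  qed
  show "E O E' \<in> controlled"
  proof (rule controlledI)
    \<comment> \<open>The step by \<open>g\<close> comes first and the action is on the left, hence
      the order \<open>h \<otimes> g\<close>.\<close>
    let ?M = "(\<lambda>(g, h). h \<otimes> g) ` (F \<times> F')"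
    \<comment> \<open>Paths with at least one exceptional step. If the exceptional step is the
      second one, the start is recovered from the middle point by \<open>inv g\<close>, so only
      finitely many such paths exist.\<close>
    let ?L = "K O K' \<union> (\<lambda>((x, y), h). (x, box_act G h y)) ` (K \<times> F')
      \<union> (\<lambda>((y, z), g). (box_act G (inv g) y, z)) ` (K' \<times> F)"
    show "E O E' \<subseteq> ?X \<times> ?X" using F F' by auto
    show "finite ?M" "?M \<subseteq> carrier G" "finite ?L"
      using F F' by (auto intro: finite_relcomp)
    fix x z assume "(x, z) \<in> E O E'" and nL: "(x, z) \<notin> ?L"
    then obtain y where y: "(x, y) \<in> E" "(y, z) \<in> E'" by auto
    then have X: "x \<in> ?X" "y \<in> ?X" using F by auto
    consider "(x, y) \<in> K" "(y, z) \<in> K'" | h where "(x, y) \<in> K" "h \<in> F'" "z = box_act G h y"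
      | g where "g \<in> F" "y = box_act G g x" "(y, z) \<in> K'"
      | g h where "g \<in> F" "y = box_act G g x" "h \<in> F'" "z = box_act G h y"
      using F(6)[OF y(1)] F'(6)[OF y(2)] by blast
    then show "\<exists>g\<in>?M. z = box_act G g x"
    proof cases
      case 1
      then show ?thesis using nL by blast
    next
      case 2
      then have "(x, z) \<in> ?L" by force
      then show ?thesis using nL by blast
    next
      case 3
      then have "x = box_act G (inv g) y"
        using F(3) X by (auto simp: box_act_inv)
      then have "(x, z) \<in> ?L" using 3 by force
      then show ?thesis using nL by blast
    next
      case 4
      then show ?thesis
        using F(3) F'(3) X by (intro bexI[of _ "h \<otimes> g"]) (auto simp: box_act_mult subset_iff)
    qed
  qed
qed

text \<open>Translation by \<open>g\<close> turns a step by \<open>h\<close> into a step by the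
  conjugate \<open>g \<otimes> h \<otimes> inv g\<close>, and it maps finite sets of pairs to finite
  sets.\<close>

lemma box_invariant_controlled: "box_invariant G controlled"
  unfolding box_invariant_def
proof (intro ballI)
  let ?X = "box_points G I S"
  fix g E assume g: "g \<in> carrier G" and "E \<in> controlled"
  let ?T = "map_prod (box_act G g) (box_act G g)"
  obtain F K where F: "E \<subseteq> ?X \<times> ?X" "finite F" "F \<subseteq> carrier G" "finite K" "K \<subseteq> E"
    "\<And>x y. (x, y) \<in> E \<Longrightarrow> (x, y) \<notin> K \<Longrightarrow> \<exists>g\<in>F. y = box_act G g x"
    using \<open>E \<in> controlled\<close> by (rule controlledE) blast
  show "?T ` E \<in> controlled"
  proof (rule controlledI)
    show "?T ` E \<subseteq> ?X \<times> ?X" "finite (?T ` K)"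
      using F(1,4) g box_act_closed by (auto simp del: split_paired_All)
    let ?M = "(\<lambda>h. g \<otimes> h \<otimes> inv g) ` F"
    show "finite ?M" "?M \<subseteq> carrier G" using F g by auto
    fix x y assume "(x, y) \<in> ?T ` E" and nK: "(x, y) \<notin> ?T ` K"
    then obtain u v where uv: "(u, v) \<in> E" "x = box_act G g u" "y = box_act G g v" by auto
    then have "(u, v) \<notin> K" using nK by force
    then obtain h where h: "h \<in> F" "v = box_act G h u" using F(6) uv(1) by blast
    have u: "u \<in> ?X" and hc: "h \<in> carrier G" using uv F h by auto
    have "box_act G (g \<otimes> h \<otimes> inv g) x = box_act G (g \<otimes> h) (box_act G (inv g) x)"
      using g hc u uv by (intro box_act_mult[symmetric]) (simp_all add: box_act_closed)
    also have "\<dots> = y"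
      using g hc u uv h by (simp add: box_act_inv box_act_mult)
    finally show "\<exists>k\<in>?M. y = box_act G k x" using h by auto
  qed
qed

text \<open>\<open>controlled\<close> is one of the structures being intersected. Conversely, each
  of these contains the graphs and, by connectedness, all singletons, hence all subsets of their
  finite unions.\<close>

lemma box_entourages_eq_controlled: "box_entourages G I S = controlled"
proof (rule antisym)
  let ?X = "box_points G I S"
  have "coarsely_connected ?X controlled"
    unfolding coarsely_connected_def
    by (auto intro!: controlledI[where F = "{}" and K = "{(x, y)}" for x y])
  moreover have "box_graph G I S g \<in> controlled" if "g \<in> carrier G" for g
    using that by (intro controlledI[where F = "{g}" and K = "{}"])
      (auto simp: box_graph_def box_act_closed)
  ultimately show "box_entourages G I S \<subseteq> controlled"
    unfolding box_entourages_def
    using coarse_structure_controlled box_invariant_controlled by blast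
  show "controlled \<subseteq> box_entourages G I S"
    unfolding box_entourages_def
  proof (intro Inter_greatest subsetI)
    fix \<E> E assume "\<E> \<in> {\<E>. coarse_structure ?X \<E> \<and> coarsely_connected ?X \<E> \<and> box_invariant G \<E> \<and>
      (\<forall>g\<in>carrier G. box_graph G I S g \<in> \<E>)}" and "E \<in> controlled"
    then have cs: "coarse_structure ?X \<E>" and cc: "coarsely_connected ?X \<E>"
      and gr: "\<And>g. g \<in> carrier G \<Longrightarrow> box_graph G I S g \<in> \<E>" by auto
    have sub: "\<And>A B. A \<in> \<E> \<Longrightarrow> B \<subseteq> A \<Longrightarrow> B \<in> \<E>" and un: "\<And>A B. A \<in> \<E> \<Longrightarrow> B \<in> \<E> \<Longrightarrow> A \<union> B \<in> \<E>"
      and "Id_on ?X \<in> \<E>"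
      using cs unfolding coarse_structure_def by blast+
    then have empty: "{} \<in> \<E>" by blast
    obtain F K where F: "E \<subseteq> ?X \<times> ?X" "finite F" "F \<subseteq> carrier G" "finite K" "K \<subseteq> E"
      "\<And>x y. (x, y) \<in> E \<Longrightarrow> (x, y) \<notin> K \<Longrightarrow> \<exists>g\<in>F. y = box_act G g x"
      using \<open>E \<in> controlled\<close> by (rule controlledE) blast
    have "(\<Union>g\<in>F. box_graph G I S g) \<in> \<E>"
      using F(2,3) by (induction F) (auto simp: empty intro: un gr)
    moreover have "K \<subseteq> ?X \<times> ?X" using F by blast
    with \<open>finite K\<close> have "K \<in> \<E>"
    proof (induction K)
      case empty
      show ?case by (rule \<open>{} \<in> \<E>\<close>)
    next
      case (insert p K)
      have "{p} \<union> K \<in> \<E>"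
        using insert cc by (intro un) (auto simp: coarsely_connected_def)
      then show ?case by simp
    qed
    ultimately have "(\<Union>g\<in>F. box_graph G I S g) \<union> K \<in> \<E>" by (rule un)
    moreover have "E \<subseteq> (\<Union>g\<in>F. box_graph G I S g) \<union> K"
      using F by (fastforce simp: box_graph_def)
    ultimately show "E \<in> \<E>" by (rule sub)
  qed
qed

lemma box_entourages_iff:
  "E \<in> box_entourages G I S \<longleftrightarrow> E \<subseteq> box_points G I S \<times> box_points G I S \<and>
     (\<exists>F K. finite F \<and> F \<subseteq> carrier G \<and> finite K \<and> E \<subseteq> orbit_rel G F \<union> K)"
  by (simp add: box_entourages_eq_controlled controlled_def)

lemma box_asdim_le_iff:
  "box_asdim G I S \<le> enat n \<longleftrightarrow>
     (\<forall>E\<in>box_entourages G I S. \<exists>D\<in>box_entourages G I S.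
        \<exists>\<U>. asdim_cover (box_points G I S) E D n \<U>)"
  unfolding box_asdim_def asdim_le_enat_iff
  by (rule asdim_le_iff_cover)
    (use coarse_structure_controlled box_entourages_eq_controlled in \<open>auto simp: coarse_structure_def\<close>)

section \<open>Passing to subfamilies\<close>

text \<open>The entourages of the subfamily are entourages of the whole box space, and those of the
  whole restrict to entourages of the subfamily.\<close>

lemma box_asdim_mono:
  assumes "J \<subseteq> I"
  shows "box_asdim G J S \<le> box_asdim G I S"
proof (cases "box_asdim G I S")
  case (enat n)
  interpret J: subgroup_family G J S using assms by (rule subfamily)
  let ?X = "box_points G I S" and ?Y = "box_points G J S"
  have YX: "?Y \<subseteq> ?X" using assms by (rule box_points_mono)
  have "box_asdim G J S \<le> enat n"
    unfolding J.box_asdim_le_iff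
  proof
    fix E assume "E \<in> box_entourages G J S"
    then have "E \<in> box_entourages G I S"
      using YX unfolding box_entourages_iff J.box_entourages_iff by blast
    then obtain D \<U> where D: "D \<in> box_entourages G I S" and "asdim_cover ?X E D n \<U>"
      using enat box_asdim_le_iff[of n] by auto
    then have "asdim_cover ?Y E (D \<inter> ?Y \<times> ?Y) n ((\<inter>) ?Y ` \<U>)"
      using YX by (intro asdim_cover_restrict) auto
    moreover have "D \<inter> ?Y \<times> ?Y \<in> box_entourages G J S"
      using D unfolding box_entourages_iff J.box_entourages_iff by blast
    ultimately show "\<exists>D\<in>box_entourages G J S. \<exists>\<U>. asdim_cover ?Y E D n \<U>" by blast
  qed
  then show ?thesis using enat by simp
qed simp

section \<open>Bad components and gluing of covers\<close>

definition bad :: "nat \<Rightarrow> 'a set \<Rightarrow> 'a set \<Rightarrow> 'i set" where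
  "bad n F D = {i\<in>I. \<nexists>\<U>. asdim_cover (box_points G {i} S) (orbit_rel G F) (orbit_rel G D) n \<U>}"

lemma infinite_bad_imp_box_asdim_gt:
  assumes F: "finite F" "F \<subseteq> carrier G" and "J \<subseteq> I"
    and inf: "\<And>D. finite D \<Longrightarrow> D \<subseteq> carrier G \<Longrightarrow> infinite (bad n F D \<inter> J)"
  shows "\<not> box_asdim G J S \<le> enat n"
proof
  assume le: "box_asdim G J S \<le> enat n"
  interpret J: subgroup_family G J S using \<open>J \<subseteq> I\<close> by (rule subfamily)
  let ?Y = "box_points G J S"
  have "orbit_rel G F \<inter> ?Y \<times> ?Y \<in> box_entourages G J S"
    using F unfolding J.box_entourages_iff by blast
  then obtain E \<U> where "E \<in> box_entourages G J S"
    and cov: "asdim_cover ?Y (orbit_rel G F \<inter> ?Y \<times> ?Y) E n \<U>"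
    using le unfolding J.box_asdim_le_iff by blast
  then obtain D K where D: "finite D" "D \<subseteq> carrier G" "finite K" "E \<subseteq> orbit_rel G D \<union> K"
    unfolding J.box_entourages_iff by blast
  \<comment> \<open>The finite set \<open>K\<close> touches finitely many components, so a bad
    component of \<open>J\<close> remains. First entries suffice, as both entries of a pair inside
    one component have the same index.\<close>
  have "infinite (bad n F D \<inter> J - (fst \<circ> fst) ` K)"
    using inf[OF D(1,2)] D(3) by (intro Diff_infinite_finite) auto
  then obtain i where i: "i \<in> bad n F D" "i \<in> J" "i \<notin> (fst \<circ> fst) ` K"
    using infinite_imp_nonempty by blast
  let ?Z = "box_points G {i} S"
  have ZY: "?Z \<subseteq> ?Y" using i by (intro box_points_mono) auto
  have "asdim_cover ?Z (orbit_rel G F) (E \<inter> ?Z \<times> ?Z) n ((\<inter>) ?Z ` \<U>)"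
    using cov ZY by (rule asdim_cover_restrict) (use ZY in blast)
  moreover have "E \<inter> ?Z \<times> ?Z \<subseteq> orbit_rel G D"
  proof -
    have "fst x = i" if "x \<in> ?Z" for x using that by (auto simp: box_points_def)
    then have "p \<notin> K" if "p \<in> ?Z \<times> ?Z" for p using that i(3) by force
    then show ?thesis using D(4) by blast
  qed
  ultimately have "asdim_cover ?Z (orbit_rel G F) (orbit_rel G D) n ((\<inter>) ?Z ` \<U>)"
    by (auto intro: asdim_cover_mono)
  then show False using i(1) by (auto simp: bad_def)
qed

lemma finite_bad_imp_cover:
  assumes fin: "\<And>i. i \<in> I \<Longrightarrow> finite (lcosets (S i))"
    and D: "finite D" "D \<subseteq> carrier G" and K: "finite K" and "finite (bad n F D)"
    and E: "E \<subseteq> box_points G I S \<times> box_points G I S" "E \<subseteq> orbit_rel G F \<union> K"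
  shows "\<exists>D\<in>box_entourages G I S. \<exists>\<U>. asdim_cover (box_points G I S) E D n \<U>"
proof -
  let ?X = "box_points G I S"
  \<comment> \<open>Both entries of the exceptional pairs count, so that no pair of \<open>K\<close>
    touches a component outside \<open>I0\<close>. The intersection with \<open>I\<close> is taken
    because \<open>K\<close> is an arbitrary finite set.\<close>
  define I0 where "I0 = I \<inter> (bad n F D \<union> (fst \<circ> fst) ` K \<union> (fst \<circ> snd) ` K)"
  define X0 where "X0 = box_points G I0 S"
  define C where "C i = box_points G {i} S" for i
  \<comment> \<open>Finite index makes each component finite, so the union \<open>X0\<close> of
    finitely many components is finite.\<close>
  have "finite I0" using assms by (auto simp: I0_def)
  then have "finite X0"
    unfolding X0_def box_points_def by (intro finite_SigmaI) (auto simp: I0_def fin)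
  have X0: "x \<in> X0 \<longleftrightarrow> x \<in> ?X \<and> fst x \<in> I0" for x
    unfolding X0_def box_points_def I0_def by (cases x) (simp, blast)
  have C: "x \<in> C i \<longleftrightarrow> x \<in> ?X \<and> fst x = i" if "i \<in> I" for x i
    using that by (auto simp: C_def box_points_def)
  have X_fst: "fst x \<in> I" if "x \<in> ?X" for x
    using that by (auto simp: box_points_def)
  have "\<exists>\<U>. asdim_cover (C i) (orbit_rel G F) (orbit_rel G D) n \<U>" if "i \<in> I - I0" for i
    using that by (auto simp: C_def I0_def bad_def)
  then obtain \<U> where \<U>:
    "\<And>i. i \<in> I - I0 \<Longrightarrow> asdim_cover (C i) (orbit_rel G F) (orbit_rel G D) n (\<U> i)"
    by metis
  define \<W> where "\<W> = insert X0 (\<Union>i\<in>I - I0. \<U> i)"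
  have \<U>_sub: "U \<subseteq> C i" if "i \<in> I - I0" "U \<in> \<U> i" for i U
    using asdim_coverD(1)[OF \<U>[OF that(1)]] that(2) by blast
  have \<U>_fst: "x \<in> ?X \<and> fst x = i" if "i \<in> I - I0" "U \<in> \<U> i" "x \<in> U" for i U x
    using \<U>_sub[OF that(1,2)] that C[of i x] by blast
  have \<U>_mesh: "U \<times> U \<subseteq> orbit_rel G D" if "i \<in> I - I0" "U \<in> \<U> i" for i U
    by (rule asdim_coverD(3)[OF \<U>[OF that(1)] that(2)])
  let ?D = "(\<Union>W\<in>\<W>. W \<times> W)"
  have W_sub: "W \<subseteq> ?X" if "W \<in> \<W>" for W
    using that \<U>_fst X0 unfolding \<W>_def by blast
  have "?D \<in> box_entourages G I S"
    unfolding box_entourages_iff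
  proof (intro conjI exI)
    show "?D \<subseteq> ?X \<times> ?X" using W_sub by blast
    \<comment> \<open>The finite square of \<open>X0\<close> is absorbed as the exceptional set of
      the mesh entourage.\<close>
    show "?D \<subseteq> orbit_rel G D \<union> X0 \<times> X0" using \<U>_mesh unfolding \<W>_def by blast
  qed (use D \<open>finite X0\<close> in auto)
  moreover have "asdim_cover ?X E ?D n \<W>"
    unfolding asdim_cover_def
  proof (intro conjI allI impI)
    show "\<W> \<subseteq> Pow ?X" using W_sub by blast
    show "\<Union>\<W> = ?X"
    proof (rule antisym)
      show "\<Union>\<W> \<subseteq> ?X" using W_sub by blast
      show "?X \<subseteq> \<Union>\<W>"
      proof
        fix x assume x: "x \<in> ?X"
        show "x \<in> \<Union>\<W>"
        proof (cases "fst x \<in> I0")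
          case True
          then show ?thesis using x X0 by (auto simp: \<W>_def)
        next
          case False
          then have i: "fst x \<in> I - I0" using x X_fst by blast
          then have "x \<in> \<Union>(\<U> (fst x))" using asdim_coverD(2)[OF \<U>[OF i]] x C i by blast
          then show ?thesis using i by (auto simp: \<W>_def)
        qed
      qed
    qed
    \<comment> \<open>A point over \<open>I0\<close> lies in the single member \<open>X0\<close>,
      while any other point meets only the cover of its own component. So the multiplicity is
      inherited from the separate covers.\<close>
    show "\<Inter>\<V> = {}" if V: "\<V> \<subseteq> \<W> \<and> card \<V> = n + 2" for \<V>
    proof (rule ccontr)
      assume "\<Inter>\<V> \<noteq> {}"
      then obtain x where x: "\<And>V. V \<in> \<V> \<Longrightarrow> x \<in> V" by blast
      show False
      proof (cases "fst x \<in> I0")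
        case True
        then have "\<V> \<subseteq> {X0}"
          using V x \<U>_fst unfolding \<W>_def by blast
        then have "card \<V> \<le> card {X0}" by (intro card_mono) auto
        then show False using V by simp
      next
        case False
        have "\<V> \<noteq> {}" using V by auto
        then have "x \<in> ?X" using V x W_sub by blast
        then have i: "fst x \<in> I - I0" using False X_fst by blast
        have "V \<in> \<U> (fst x)" if "V \<in> \<V>" for V
        proof -
          have "V \<in> \<W>" "V \<noteq> X0" using V x that False X0 by blast+
          then obtain j where "j \<in> I - I0" "V \<in> \<U> j" by (auto simp: \<W>_def)
          then show ?thesis using \<U>_fst x that by blast
        qed
        then have "\<Inter>\<V> = {}" using asdim_coverD(4)[OF \<U>[OF i]] V by blast
        then show False using \<open>\<Inter>\<V> \<noteq> {}\<close> by simp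
      qed
    qed
    show "\<exists>W\<in>\<W>. A \<subseteq> W" if A: "A \<noteq> {} \<and> A \<subseteq> ?X \<and> A \<times> A \<subseteq> E" for A
    proof (cases "A \<subseteq> X0")
      case True
      then show ?thesis by (auto simp: \<W>_def)
    next
      case False
      \<comment> \<open>The component of \<open>a\<close> is untouched by \<open>K\<close>, so every
        pair of \<open>A \<times> A\<close> containing \<open>a\<close> is an orbit pair. This
        confines \<open>A\<close> to that component, where the local cover has the required
        scale.\<close>
      then obtain a where a: "a \<in> A" "a \<in> ?X" "fst a \<notin> I0" using A X0 by blast
      then have i: "fst a \<in> I - I0" using X_fst by blast
      have aK: "(x, y) \<notin> K" if "fst x = fst a \<or> fst y = fst a" for x y
        using i that by (force simp: I0_def)
      have eq: "fst x = fst a" if "x \<in> A" for x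
      proof -
        have "(a, x) \<in> orbit_rel G F \<union> K" using a that A E(2) by blast
        then show ?thesis using aK orbit_rel_same_fst by fastforce
      qed
      have "A \<times> A \<subseteq> orbit_rel G F"
        using A E(2) aK eq by blast
      moreover have "A \<subseteq> C (fst a)" using eq A C i by blast
      ultimately obtain U where "U \<in> \<U> (fst a)" "A \<subseteq> U"
        using asdim_coverD(5)[OF \<U>[OF i], of A] A by auto
      then show ?thesis using i by (auto simp: \<W>_def)
    qed
  qed simp
  ultimately show ?thesis by blast
qed

section \<open>Reduction to countable subfamilies\<close>

lemma box_asdim_eq_SUP_cofinal:
  assumes fin: "\<And>i. i \<in> I \<Longrightarrow> finite (lcosets (S i))" and count: "countable (carrier G)"
    and sub: "\<And>J. J \<in> \<J> \<Longrightarrow> J \<subseteq> I"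
    and cofinal: "\<And>J. J \<subseteq> I \<Longrightarrow> countable J \<Longrightarrow> \<exists>J'\<in>\<J>. J \<subseteq> J'"
  shows "box_asdim G I S = (SUP J\<in>\<J>. box_asdim G J S)"
proof (rule antisym)
  show "(SUP J\<in>\<J>. box_asdim G J S) \<le> box_asdim G I S"
    by (intro SUP_least box_asdim_mono sub)
  show "box_asdim G I S \<le> (SUP J\<in>\<J>. box_asdim G J S)"
  proof (cases "SUP J\<in>\<J>. box_asdim G J S")
    case (enat n)
    then have le: "box_asdim G J S \<le> enat n" if "J \<in> \<J>" for J
      using that by (metis SUP_upper)
    have "box_asdim G I S \<le> enat n"
      unfolding box_asdim_le_iff
    proof
      fix E assume "E \<in> box_entourages G I S"
      then obtain F K where F: "E \<subseteq> box_points G I S \<times> box_points G I S" "finite F" "F \<subseteq> carrier G"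
        "finite K" "E \<subseteq> orbit_rel G F \<union> K"
        unfolding box_entourages_iff by blast
      let ?\<D> = "{D. finite D \<and> D \<subseteq> carrier G}"
      \<comment> \<open>Otherwise countably infinite sets \<open>B D\<close> of bad components can
        be collected over all \<open>D\<close>. A member of \<open>\<J>\<close> containing them all
        would have dimension greater than \<open>n\<close>.\<close>
      have "\<exists>D\<in>?\<D>. finite (bad n F D)"
      proof (rule ccontr)
        assume "\<not> ?thesis"
        then have "\<exists>B. B \<subseteq> bad n F D \<and> countable B \<and> infinite B" if "D \<in> ?\<D>" for D
          using that infinite_countable_subset'[of "bad n F D"] by blast
        then obtain B where B:
          "\<And>D. D \<in> ?\<D> \<Longrightarrow> B D \<subseteq> bad n F D \<and> countable (B D) \<and> infinite (B D)"
          by metis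
        \<comment> \<open>Countability of the group enters here: it keeps the union of all
          \<open>B D\<close> countable, so that cofinality applies.\<close>
        have "countable ?\<D>"
          using countable_Collect_finite_subset[OF count] by simp
        then have "countable (\<Union>D\<in>?\<D>. B D)" by (rule countable_UN) (use B in blast)
        moreover have "(\<Union>D\<in>?\<D>. B D) \<subseteq> I" using B by (auto simp: bad_def)
        ultimately obtain J where J: "J \<in> \<J>" "(\<Union>D\<in>?\<D>. B D) \<subseteq> J" using cofinal by metis
        have "infinite (bad n F D \<inter> J)" if "finite D" "D \<subseteq> carrier G" for D
        proof -
          have "B D \<subseteq> bad n F D \<inter> J" "infinite (B D)" using B[of D] J(2) that by blast+
          then show ?thesis using finite_subset by blast
        qed
        then show False
          using infinite_bad_imp_box_asdim_gt[OF F(2,3) sub[OF J(1)]] le[OF J(1)] by blast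
      qed
      then show "\<exists>D\<in>box_entourages G I S. \<exists>\<U>. asdim_cover (box_points G I S) E D n \<U>"
        using finite_bad_imp_cover[OF fin _ _ F(4) _ F(1,5)] by blast
    qed
    then show ?thesis using enat by simp
  qed simp
qed

end

text \<open>Closing \<open>J\<close> under a choice \<open>k\<close> of lower bounds takes countably
  many rounds, each adding countably many indices.\<close>

lemma countable_nested_superfamily:
  assumes "nested_family I S" "J \<subseteq> I" "countable J"
  shows "\<exists>J'. J \<subseteq> J' \<and> J' \<subseteq> I \<and> countable J' \<and> nested_family J' S"
proof -
  obtain k where k: "\<And>i j. i \<in> I \<Longrightarrow> j \<in> I \<Longrightarrow> k i j \<in> I \<and> S (k i j) \<subseteq> S i \<and> S (k i j) \<subseteq> S j"
    using assms(1) unfolding nested_family_def by metis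
  define T where "T n = ((\<lambda>A. A \<union> (\<lambda>(i, j). k i j) ` (A \<times> A)) ^^ n) J" for n
  have T0: "T 0 = J" and TSuc: "T (Suc n) = T n \<union> (\<lambda>(i, j). k i j) ` (T n \<times> T n)" for n
    by (simp_all add: T_def)
  have TI: "T n \<subseteq> I" for n
  proof (induction n)
    case (Suc n)
    then show ?case using k by (auto simp: TSuc subset_iff)
  qed (simp add: T0 assms)
  have Tc: "countable (T n)" for n
    by (induction n) (use assms in \<open>auto simp: T0 TSuc\<close>)
  have mono: "T m \<subseteq> T n" if "m \<le> n" for m n
    using that by (rule lift_Suc_mono_le[rotated]) (auto simp: TSuc)
  have "nested_family (\<Union>n. T n) S"
    unfolding nested_family_def
  proof (intro ballI)
    fix i j assume "i \<in> (\<Union>n. T n)" "j \<in> (\<Union>n. T n)"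
    then obtain m n where "i \<in> T m" "j \<in> T n" by blast
    \<comment> \<open>Two indices appear together at some stage, and their chosen lower bound is
      added at the next one.\<close>
    then have ij: "i \<in> T (max m n)" "j \<in> T (max m n)"
      using mono[of m "max m n"] mono[of n "max m n"] by auto
    then have "k i j \<in> T (Suc (max m n))" by (auto simp: TSuc)
    then show "\<exists>l\<in>\<Union>n. T n. S l \<subseteq> S i \<and> S l \<subseteq> S j"
      using k[of i j] ij TI by blast
  qed
  moreover have "J \<subseteq> (\<Union>n. T n)" using T0 by blast
  ultimately show ?thesis using TI Tc by (intro exI[of _ "\<Union>n. T n"]) blast
qed

theorem proposition3p7:
  fixes G :: "('a, 'm) monoid_scheme" and I :: "'i set" and S :: "'i \<Rightarrow> 'a set"
  assumes "group G" and "countable (carrier G)"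
    and "\<And>i. i \<in> I \<Longrightarrow> subgroup (S i) G"
    and "\<And>i. i \<in> I \<Longrightarrow> finite (lcosets\<^bsub>G\<^esub> (S i))"
  shows "box_asdim G I S = (SUP J\<in>{J. J \<subseteq> I \<and> countable J}. box_asdim G J S) \<and>
         (nested_family I S \<longrightarrow>
            box_asdim G I S =
              (SUP J\<in>{J. J \<subseteq> I \<and> countable J \<and> nested_family J S}. box_asdim G J S))"
proof -
  interpret group G by fact
  interpret subgroup_family G I S
    by (intro subgroup_family.intro subgroup_family_axioms.intro assms(1,3))
  show ?thesis
  proof (intro conjI impI)
    show "box_asdim G I S = (SUP J\<in>{J. J \<subseteq> I \<and> countable J}. box_asdim G J S)"
      \<comment> \<open>Cofinality is immediate: a countable subfamily is itself a member of the
        class.\<close>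
      by (rule box_asdim_eq_SUP_cofinal) (use assms in auto)
    assume nested: "nested_family I S"
    show "box_asdim G I S =
        (SUP J\<in>{J. J \<subseteq> I \<and> countable J \<and> nested_family J S}. box_asdim G J S)"
    proof (rule box_asdim_eq_SUP_cofinal)
      show "\<exists>J'\<in>{J. J \<subseteq> I \<and> countable J \<and> nested_family J S}. J \<subseteq> J'"
        if "J \<subseteq> I" "countable J" for J
        using countable_nested_superfamily[OF nested that] by blast
    qed (use assms in auto)
  qed
qed

end
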